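(* Let $\epsilon>0$, $n\ge1$, $T>0$. Consider the relativistic Euler equations $$\partial_t\Bigl(\frac{\rho+\epsilon^2 p}{1-\epsilon^2|u|^2}-\epsilon^2 p\Bigr)+\sum_{k=1}^n\partial_{x_k}\Bigl(\frac{\rho+\epsilon^2 p}{1-\epsilon^2|u|^2}u_k\Bigr)=0,$$ $$\partial_t\Bigl(\frac{\rho+\epsilon^2 p}{1-\epsilon^2|u|^2}u_j\Bigr)+\sum_{k=1}^n\partial_{x_k}\Bigl(\frac{\rho+\epsilon^2 p}{1-\epsilon^2|u|^2}u_ju_k+p\,\delta_{jk}\Bigr)=0,\quad 1\le j\le n,$$ for an equation of state $p=p(\rho)$ satisfying the hyperbolicity condition $0\le p'(\rho)<\epsilon^{-2}$ together with the vacuum condition $$\limsup_{\rho\to0,\ \rho>0}\frac{c(\rho)}{w(\rho)}<\infty.$$ If $(\rho,u)$ is a tame solution of the relativistic Euler equations on $[0,T]$ and has compact support, then its support does not expand in time, that is, $$\mathrm{supp}(\rho,u)(t)\subset\mathrm{supp}(\overline\rho,\overline u),\qquad t\in[0,T],$$ where $(\overline\rho,\overline u)=(\rho,u)(0,\cdot)$.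
   Context: The unknowns are the mass density $\rho=\rho(t,x)\ge0$ and velocity vector $u=u(t,x)\in\mathbb{R}^n$ with $|u|<1/\epsilon$; $1/\epsilon$ is the light speed and $\delta_{jk}$ is the Kronecker symbol. The pressure $p=p(\rho)$ is a regular function of $\rho\ge0$. Definitions: $c(\rho)=\sqrt{p'(\rho)}$, $q(\rho)=\rho+\epsilon^2p(\rho)$ (positive for $\rho>0$), and $w(\rho)=\int_0^\rho\frac{c(s)}{q(s)}\,ds$, assumed finite. Tame solution: a measurable map $(\rho,u):[0,T]\times\mathbb{R}^n\to[0,\infty)\times\{u\in\mathbb{R}^n:|u|<1/\epsilon\}$ is called a tame solution of the relativistic Euler equations if (i) $(\rho,u)$ is a solution of class $C^1$ of the Euler equations; (ii) $w=w(\rho)$ is also of class $C^1$; and (iii) the equation $\partial_tu+u\cdot\nabla u=0$ holds in the interior of the set $\{\rho=0\}$. *)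

theory Defs
  imports "HOL-Analysis.Analysis"
begin

text \<open>Class C1 on a set that need not be open: one-sided (relative) derivatives on the boundary.\<close>

definition C1_on :: "'a::real_normed_vector set \<Rightarrow> ('a \<Rightarrow> 'b::real_normed_vector) \<Rightarrow> bool"
  where "C1_on S f \<longleftrightarrow>
    (\<exists>f' :: 'a \<Rightarrow> 'a \<Rightarrow>\<^sub>L 'b.
       (\<forall>x\<in>S. (f has_derivative blinfun_apply (f' x)) (at x within S)) \<and> continuous_on S f')"

abbreviation slab :: "real \<Rightarrow> (real \<times> (real ^ 'n)) set"
  where "slab T \<equiv> {0..T} \<times> UNIV"

text \<open>The time derivative is one-sided at the end points of the interval.\<close>

definition d_t :: "real \<Rightarrow> (real \<times> (real ^ 'n) \<Rightarrow> 'b::real_normed_vector) \<Rightarrow> real \<times> (real ^ 'n) \<Rightarrow> 'b"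
  where "d_t T F z = vector_derivative (\<lambda>s. F (s, snd z)) (at (fst z) within {0..T})"

definition d_x :: "'n \<Rightarrow> (real \<times> (real ^ 'n) \<Rightarrow> 'b::real_normed_vector) \<Rightarrow> real \<times> (real ^ 'n) \<Rightarrow> 'b"
  where "d_x k F z = vector_derivative (\<lambda>h. F (fst z, snd z + h *\<^sub>R axis k 1)) (at 0)"

text \<open>The pressure matters only on the half line of nonnegative densities, so its derivative at 0
  is the right derivative.\<close>

definition dpress :: "(real \<Rightarrow> real) \<Rightarrow> real \<Rightarrow> real"
  where "dpress p r = vector_derivative p (at r within {0..})"

definition sound :: "(real \<Rightarrow> real) \<Rightarrow> real \<Rightarrow> real"
  where "sound p r = sqrt (dpress p r)"

definition qfun :: "real \<Rightarrow> (real \<Rightarrow> real) \<Rightarrow> real \<Rightarrow> real"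
  where "qfun \<epsilon> p r = r + \<epsilon>\<^sup>2 * p r"

definition wfun :: "real \<Rightarrow> (real \<Rightarrow> real) \<Rightarrow> real \<Rightarrow> real"
  where "wfun \<epsilon> p r = integral {0..r} (\<lambda>s. sound p s / qfun \<epsilon> p s)"

definition energy_inertia ::
    "real \<Rightarrow> (real \<Rightarrow> real) \<Rightarrow> (real \<times> (real ^ 'n) \<Rightarrow> real) \<Rightarrow> (real \<times> (real ^ 'n) \<Rightarrow> real ^ 'n)
      \<Rightarrow> real \<times> (real ^ 'n) \<Rightarrow> real"
  where "energy_inertia \<epsilon> p \<rho> u z =
    (\<rho> z + \<epsilon>\<^sup>2 * p (\<rho> z)) / (1 - \<epsilon>\<^sup>2 * (norm (u z))\<^sup>2)"

definition rel_euler ::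
    "real \<Rightarrow> (real \<Rightarrow> real) \<Rightarrow> real \<Rightarrow> (real \<times> (real ^ 'n) \<Rightarrow> real)
      \<Rightarrow> (real \<times> (real ^ 'n) \<Rightarrow> real ^ 'n) \<Rightarrow> bool"
  where "rel_euler \<epsilon> p T \<rho> u \<longleftrightarrow>
    (\<forall>z\<in>slab T.
       d_t T (\<lambda>y. energy_inertia \<epsilon> p \<rho> u y - \<epsilon>\<^sup>2 * p (\<rho> y)) z
         + (\<Sum>k\<in>UNIV. d_x k (\<lambda>y. energy_inertia \<epsilon> p \<rho> u y * u y $ k) z) = 0
     \<and> (\<forall>j.
       d_t T (\<lambda>y. energy_inertia \<epsilon> p \<rho> u y * u y $ j) z
         + (\<Sum>k\<in>UNIV. d_x k (\<lambda>y. energy_inertia \<epsilon> p \<rho> u y * u y $ j * u y $ k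
                                  + p (\<rho> y) * (if j = k then 1 else 0)) z) = 0))"

text \<open>The interior of the vacuum set is taken in space-time, so it contains no point with
  \<open>t = 0\<close> or \<open>t = T\<close>; since \<open>u\<close> is C1 up to these times, taking the interior relative
  to the slab would give the same condition.\<close>

definition tame_solution ::
    "real \<Rightarrow> (real \<Rightarrow> real) \<Rightarrow> real \<Rightarrow> (real \<times> (real ^ 'n) \<Rightarrow> real)
      \<Rightarrow> (real \<times> (real ^ 'n) \<Rightarrow> real ^ 'n) \<Rightarrow> bool"
  where "tame_solution \<epsilon> p T \<rho> u \<longleftrightarrow>
    (\<lambda>z. (\<rho> z, u z)) \<in> borel_measurable (lebesgue_on (slab T)) \<and>
    (\<forall>z\<in>slab T. 0 \<le> \<rho> z \<and> norm (u z) < 1 / \<epsilon>) \<and>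
    C1_on (slab T) (\<lambda>z. (\<rho> z, u z)) \<and>
    rel_euler \<epsilon> p T \<rho> u \<and>
    C1_on (slab T) (\<lambda>z. wfun \<epsilon> p (\<rho> z)) \<and>
    (\<forall>z\<in>interior {y \<in> slab T. \<rho> y = 0}.
       d_t T u z + (\<Sum>k\<in>UNIV. (u z $ k) *\<^sub>R d_x k u z) = 0)"

definition supp_on :: "'a::topological_space set \<Rightarrow> ('a \<Rightarrow> 'b::zero) \<Rightarrow> 'a set"
  where "supp_on S f = S \<inter> closure {x \<in> S. f x \<noteq> 0}"

end

theory Submission imports Defs begin

text \<open>
  In the variables \<open>(w, u)\<close> the Euler equations take a form in which every term of the time
  derivative carries a factor \<open>c\<close> or \<open>u\<close>. By continuity this form extends from
  \<open>{\<rho> > 0}\<close> to the whole slab, because it also holds in the interior of the vacuum. The vacuum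
  condition bounds \<open>c\<close> by a multiple of \<open>w\<close> for small \<open>\<rho>\<close>, so at each fixed point \<open>x\<close> one has
  \<open>\<bar>\<partial>\<^sub>t (w, u)\<bar> \<le> M \<bar>(w, u)\<bar>\<close>, and Gronwall's inequality keeps \<open>(w, u)\<close> at zero wherever it
  starts at zero.
\<close>

text \<open>The choice of w comes from the momentum equation. It carries the factor q before the
  time derivative of u and p' = c^2 before the gradient of the density. Dividing by q, which may
  vanish at the vacuum, leaves (c^2 / q) grad rho = c grad w, and tameness makes grad w continuous
  up to the vacuum. The spatial derivatives of w and u are never estimated by (w, u). They are
  treated as given continuous coefficients, bounded along the segment of all times at one point x;
  what is small are the factors c and u in front of them. Thus x is a mere parameter in an ordinary
  differential inequality in t. The vacuum condition is used twice: for c <= C w at small densities,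
  and, in the limit of zero density, for c(0) = 0. The latter removes every term with a factor c
  inside the vacuum, so that condition (iii) of tameness becomes the velocity equation
  there.\<close>

section \<open>Partial derivatives and the pressure law\<close>

lemma d_t_eq:
  assumes "0 < T" and z: "z \<in> slab T" and F: "(F has_derivative F') (at z within slab T)"
  shows "d_t T F z = F' (1, 0)"
    and "((\<lambda>s. F (s, snd z)) has_vector_derivative F' (1, 0)) (at (fst z) within {0..T})"
proof -
  have z': "fst z \<in> {0..T}" using z by auto
  have "((\<lambda>s. (s, snd z)) has_derivative (\<lambda>h. (h, 0))) (at (fst z) within {0..T})"
    by (auto intro!: derivative_eq_intros)
  moreover have "(F has_derivative F') (at (fst z, snd z) within (\<lambda>s. (s, snd z)) ` {0..T})"
    using z by (auto intro!: has_derivative_subset[OF F])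
  ultimately have "((\<lambda>s. F (s, snd z)) has_derivative (\<lambda>h. F' (h, 0))) (at (fst z) within {0..T})"
    by (rule has_derivative_in_compose)
  moreover have "F' (h, 0) = h *\<^sub>R F' (1, 0)" for h
    using linear_cmul[OF has_derivative_linear[OF F], of h "(1, 0)"] by simp
  then have "(\<lambda>h. F' (h, 0)) = (\<lambda>h. h *\<^sub>R F' (1, 0))" by (rule ext)
  ultimately show v: "((\<lambda>s. F (s, snd z)) has_vector_derivative F' (1, 0)) (at (fst z) within {0..T})"
    unfolding has_vector_derivative_def by (rule has_derivative_eq_rhs)
  show "d_t T F z = F' (1, 0)"
    unfolding d_t_def using v z' \<open>0 < T\<close>
    by (intro vector_derivative_within_cbox[of 0 T, unfolded box_real]) auto
qed

text \<open>A line in a spatial direction never leaves the slab, so the derivative within the slab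
  yields a two-sided derivative along it, also at the first and the last time.\<close>

lemma d_x_eq:
  assumes z: "z \<in> slab T" and F: "(F has_derivative F') (at z within slab T)"
  shows "d_x k F z = F' (0, axis k 1)"
proof -
  have "((\<lambda>h. (fst z, snd z + h *\<^sub>R axis k 1)) has_derivative (\<lambda>h. (0, h *\<^sub>R axis k 1))) (at 0)"
    by (auto intro!: derivative_eq_intros)
  moreover have "(F has_derivative F') (at (fst z, snd z + 0 *\<^sub>R axis k 1)
      within (\<lambda>h. (fst z, snd z + h *\<^sub>R axis k 1)) ` UNIV)"
    using z by (auto intro!: has_derivative_subset[OF F])
  ultimately have "((\<lambda>h. F (fst z, snd z + h *\<^sub>R axis k 1)) has_derivative
      (\<lambda>h. F' (0, h *\<^sub>R axis k 1))) (at 0)"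
    using has_derivative_in_compose by blast
  moreover have "F' (0, h *\<^sub>R axis k 1) = h *\<^sub>R F' (0, axis k 1)" for h
    using linear_cmul[OF has_derivative_linear[OF F], of h "(0, axis k 1)"] by simp
  ultimately show ?thesis
    unfolding d_x_def by (intro vector_derivative_at) (simp add: has_vector_derivative_def)
qed

lemma pressure_derivative:
  assumes "C1_on {0..} p"
  shows "\<And>r. 0 \<le> r \<Longrightarrow> (p has_real_derivative dpress p r) (at r within {0..})"
    and "continuous_on {0..} (dpress p)"
proof -
  obtain p' where p': "\<And>r. 0 \<le> r \<Longrightarrow> (p has_derivative blinfun_apply (p' r)) (at r within {0..})"
    and cont: "continuous_on {0..} p'"
    using assms unfolding C1_on_def by auto
  have v: "(p has_vector_derivative p' r 1) (at r within {0..})" if "0 \<le> r" for r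
  proof -
    have "blinfun_apply (p' r) h = h *\<^sub>R p' r 1" for h
      using blinfun.scaleR_right[of "p' r" h 1] by simp
    then have "blinfun_apply (p' r) = (\<lambda>h. h *\<^sub>R p' r 1)" ..
    then show ?thesis using p'[OF that] by (simp add: has_vector_derivative_def)
  qed
  \<comment> \<open>Right neighbourhoods of \<open>r\<close> stay in the half line, so the
    derivative within it is unique at 0 as well.\<close>
  have nb: "at r within {0..} \<noteq> bot" if "0 \<le> r" for r :: real
  proof -
    have "at r within {r..} \<le> at r within {0..}" using that by (intro at_le) auto
    moreover have "at r within {r..} \<noteq> bot" by (simp add: at_within_Ici_at_right)
    ultimately show ?thesis by (metis bot.extremum_uniqueI)
  qed
  have d: "dpress p r = p' r 1" if "0 \<le> r" for r
    unfolding dpress_def using vector_derivative_within[OF nb[OF that] v[OF that]] .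
  show "(p has_real_derivative dpress p r) (at r within {0..})" if "0 \<le> r" for r
    using v[OF that] d[OF that] by (simp add: has_real_derivative_iff_has_vector_derivative)
  have "continuous_on {0..} (\<lambda>r. blinfun_apply (p' r) 1)"
    by (intro continuous_intros cont)
  then show "continuous_on {0..} (dpress p)"
    by (rule continuous_on_cong[THEN iffD1, rotated 2]) (auto simp: d)
qed

lemma continuous_on_sound:
  assumes "C1_on {0..} p"
  shows "continuous_on {0..} (sound p)"
  unfolding sound_def[abs_def] by (intro continuous_intros pressure_derivative(2)[OF assms])

lemma continuous_on_qfun:
  assumes "C1_on {0..} p"
  shows "continuous_on {0..} (qfun \<epsilon> p)"
proof -
  have "continuous_on {0..} p"
    using DERIV_continuous_on pressure_derivative(1)[OF assms] by (metis atLeast_iff)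
  then show ?thesis unfolding qfun_def[abs_def] by (intro continuous_intros)
qed

section \<open>The function w and the vacuum condition\<close>

context
  fixes \<epsilon> :: real and p :: "real \<Rightarrow> real"
  assumes p_regular: "C1_on {0..} p"
    and dpress_nonneg: "\<And>r. 0 \<le> r \<Longrightarrow> 0 \<le> dpress p r"
    and q_pos: "\<And>r. 0 < r \<Longrightarrow> 0 < qfun \<epsilon> p r"
    and w_finite: "\<And>r. 0 \<le> r \<Longrightarrow> (\<lambda>s. sound p s / qfun \<epsilon> p s) integrable_on {0..r}"
begin

lemma continuous_on_integrand: "continuous_on {0<..} (\<lambda>s. sound p s / qfun \<epsilon> p s)"
  using q_pos
  by (intro continuous_intros continuous_on_subset[OF continuous_on_sound[OF p_regular]]
      continuous_on_subset[OF continuous_on_qfun[OF p_regular]]) fastforce+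

lemma wfun_split:
  assumes "0 \<le> a" "a \<le> r"
  shows "wfun \<epsilon> p r = wfun \<epsilon> p a + integral {a..r} (\<lambda>s. sound p s / qfun \<epsilon> p s)"
  unfolding wfun_def using assms w_finite
  by (intro Henstock_Kurzweil_Integration.integral_combine[symmetric]) auto

text \<open>The integrand may be singular at 0. Splitting the integral at \<open>r/2\<close> leaves
  a constant and an integral of a continuous function.\<close>

lemma wfun_has_derivative:
  assumes "0 < r"
  shows "(wfun \<epsilon> p has_real_derivative sound p r / qfun \<epsilon> p r) (at r)"
proof -
  have "((\<lambda>s. integral {r/2..s} (\<lambda>s. sound p s / qfun \<epsilon> p s)) has_real_derivative
      sound p r / qfun \<epsilon> p r) (at r within {r/2..r+1})"
    using assms
    by (intro integral_has_real_derivative continuous_on_subset[OF continuous_on_integrand]) auto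
  then have "((\<lambda>s. integral {r/2..s} (\<lambda>s. sound p s / qfun \<epsilon> p s)) has_real_derivative
      sound p r / qfun \<epsilon> p r) (at r)"
    using assms by (subst (asm) at_within_interior) (auto simp: interior_atLeastAtMost_real)
  then have "((\<lambda>s. wfun \<epsilon> p (r/2) + integral {r/2..s} (\<lambda>s. sound p s / qfun \<epsilon> p s))
      has_real_derivative sound p r / qfun \<epsilon> p r) (at r)"
    by (auto intro!: derivative_eq_intros)
  then show ?thesis
  proof (rule DERIV_cong_ev[THEN iffD1, rotated -1])
    have "eventually (\<lambda>s. r/2 < s) (nhds r)"
      using assms eventually_nhds_in_open[of "{r/2<..}" r] by auto
    then show "\<forall>\<^sub>F s in nhds r. wfun \<epsilon> p (r/2) + integral {r/2..s} (\<lambda>s. sound p s / qfun \<epsilon> p s)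
        = wfun \<epsilon> p s"
      by eventually_elim (rule wfun_split[symmetric], use assms in auto)
  qed auto
qed

lemma sound_nonneg: "0 \<le> r \<Longrightarrow> 0 \<le> sound p r"
  by (simp add: sound_def dpress_nonneg)

lemma integrand_nonneg: "0 < s \<Longrightarrow> 0 \<le> sound p s / qfun \<epsilon> p s"
  using q_pos sound_nonneg by (simp add: less_imp_le)

lemma wfun_nonneg:
  assumes "0 \<le> r" shows "0 \<le> wfun \<epsilon> p r"
proof -
  \<comment> \<open>\<open>q_pos\<close> gives no sign at 0, so the integrand is changed on this
    null set to be nonnegative throughout.\<close>
  let ?f = "\<lambda>s. if s = 0 then 0 else sound p s / qfun \<epsilon> p s"
  have "?f integrable_on {0..r}"
    by (rule integrable_spike[OF w_finite[OF assms], of "{0}"]) auto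
  then have "0 \<le> integral {0..r} ?f"
    using integrand_nonneg by (intro integral_nonneg) auto
  also have "\<dots> = wfun \<epsilon> p r"
    unfolding wfun_def by (rule integral_spike[of "{0}"]) auto
  finally show ?thesis .
qed

text \<open>The vacuum condition says nothing where \<open>w = 0\<close>, since \<open>c / 0 = 0\<close> in HOL; there
  \<open>c\<close> vanishes as well.\<close>

lemma sound_eq_0_if_wfun_eq_0:
  assumes "0 < r" "wfun \<epsilon> p r = 0"
  shows "sound p r = 0"
proof -
  let ?f = "\<lambda>s. sound p s / qfun \<epsilon> p s"
  have c: "continuous_on {r/2..r} ?f"
    using assms by (intro continuous_on_subset[OF continuous_on_integrand]) auto
  have "0 \<le> integral {r/2..r} ?f"
    using assms integrand_nonneg by (intro integral_nonneg integrable_continuous_interval c) auto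
  \<comment> \<open>w(r/2) and the integral over the rest are nonnegative with sum zero; a
    continuous nonnegative integrand must then vanish, in particular at \<open>r\<close>.\<close>
  then have "integral {r/2..r} ?f = 0"
    using wfun_split[of "r/2" r] wfun_nonneg[of "r/2"] assms by simp
  then have "\<forall>s\<in>{r/2..r}. ?f s = 0"
    using integral_eq_0_iff[OF c] integrand_nonneg assms by auto
  then have "?f r = 0" using assms by simp
  then show ?thesis using q_pos[OF assms(1)] by simp
qed

lemma sound_le_wfun:
  assumes "Limsup (at_right 0) (\<lambda>r. ereal (sound p r / wfun \<epsilon> p r)) < \<infinity>"
  obtains C \<delta> where "0 \<le> C" "0 < \<delta>" "\<And>r. 0 \<le> r \<Longrightarrow> r < \<delta> \<Longrightarrow> sound p r \<le> C * wfun \<epsilon> p r"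
proof -
  obtain n :: nat where "Limsup (at_right 0) (\<lambda>r. ereal (sound p r / wfun \<epsilon> p r)) < ereal (real n)"
    using assms less_PInf_Ex_of_nat by auto
  from Limsup_lessD[OF this]
  have "\<forall>\<^sub>F r in at_right 0. sound p r / wfun \<epsilon> p r < n" by simp
  then obtain \<delta> where "0 < \<delta>" and \<delta>: "\<And>r. 0 < r \<Longrightarrow> r < \<delta> \<Longrightarrow> sound p r / wfun \<epsilon> p r < n"
    unfolding eventually_at_right_field by auto
  have pos: "sound p r \<le> n * wfun \<epsilon> p r" if "0 < r" "r < \<delta>" for r
  proof (cases "wfun \<epsilon> p r = 0")
    case True
    then show ?thesis using sound_eq_0_if_wfun_eq_0 that by simp
  next
    case False
    then have "0 < wfun \<epsilon> p r" using wfun_nonneg[of r] that by simp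
    then show ?thesis using \<delta>[OF that] by (simp add: field_simps)
  qed
  \<comment> \<open>The endpoint 0 is reached as a limit from the right. Since w(0) = 0, including
    it forces c(0) = 0.\<close>
  have "continuous_on {0..\<delta>} (wfun \<epsilon> p)"
    unfolding wfun_def[abs_def] using \<open>0 < \<delta>\<close> by (intro indefinite_integral_continuous_1 w_finite) simp
  moreover have "continuous_on {0..\<delta>} (sound p)"
    by (rule continuous_on_subset[OF continuous_on_sound[OF p_regular]]) auto
  ultimately have "continuous_on {0..\<delta>} (\<lambda>r. n * wfun \<epsilon> p r - sound p r)"
    by (intro continuous_intros)
  then have "((\<lambda>r. n * wfun \<epsilon> p r - sound p r) \<longlongrightarrow> n * wfun \<epsilon> p 0 - sound p 0) (at_right 0)"
    using \<open>0 < \<delta>\<close> unfolding continuous_on_def at_within_Icc_at_right[OF \<open>0 < \<delta>\<close>, symmetric]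
    by (meson atLeastAtMost_iff less_imp_le order_refl)
  then have "0 \<le> n * wfun \<epsilon> p 0 - sound p 0"
  proof (rule tendsto_lowerbound)
    show "\<forall>\<^sub>F r in at_right 0. 0 \<le> n * wfun \<epsilon> p r - sound p r"
      unfolding eventually_at_right_field using pos \<open>0 < \<delta>\<close> by auto
  qed simp
  then show ?thesis
    using pos \<open>0 < \<delta>\<close> by (intro that[of n \<delta>]) (auto simp: le_less)
qed

end

section \<open>A differential inequality and a density argument\<close>

text \<open>The integrating factor \<open>exp (- L * s)\<close> makes the product \<open>g\<close>
  nonincreasing, by the mean value theorem. The case \<open>L = 0\<close> serves the
  density.\<close>

lemma gronwall_zero:
  fixes y y' :: "real \<Rightarrow> real"
  assumes "a \<le> b"
    and y': "\<And>t. t \<in> {a..b} \<Longrightarrow> (y has_real_derivative y' t) (at t within {a..b})"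
    and le: "\<And>t. t \<in> {a..b} \<Longrightarrow> y' t \<le> L * y t"
    and "y a = 0" "\<And>t. t \<in> {a..b} \<Longrightarrow> 0 \<le> y t" and t: "t \<in> {a..b}"
  shows "y t = 0"
proof -
  define g where "g s = exp (- L * s) * y s" for s
  have g': "(g has_real_derivative exp (- L * s) * (y' s - L * y s)) (at s within {a..t})"
    if "s \<in> {a..t}" for s
  proof -
    have "(y has_real_derivative y' s) (at s within {a..t})"
      using that t by (intro DERIV_subset[OF y']) auto
    then show ?thesis unfolding g_def
      by (auto intro!: derivative_eq_intros simp: algebra_simps)
  qed
  obtain s where s: "s \<in> {a..t}" and "g t - g a = exp (- L * s) * (y' s - L * y s) * (t - a)"
    using mvt_very_simple[of a t g "\<lambda>s h. exp (- L * s) * (y' s - L * y s) * h"] g' t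
    by (auto simp: has_field_derivative_def)
  moreover have "y' s - L * y s \<le> 0" using le[of s] s t by auto
  ultimately have "g t \<le> g a"
    using t by (smt (verit) atLeastAtMost_iff exp_gt_zero mult_nonneg_nonpos mult_nonpos_nonneg)
  then have "y t \<le> 0" using assms by (simp add: g_def mult_le_0_iff)
  then show ?thesis using assms by force
qed

text \<open>Positive density and the interior of the vacuum together fill a dense subset of the
  slab: an open set of points at inner times without positive density lies in that interior.\<close>

lemma slab_dense:
  fixes G :: "real \<times> (real ^ 'n) \<Rightarrow> real"
  assumes "0 < T" and G: "continuous_on (slab T) G"
    and nonneg: "\<And>z. z \<in> slab T \<Longrightarrow> (0::real) \<le> \<rho> z"
    and pos: "\<And>z. z \<in> slab T \<Longrightarrow> 0 < \<rho> z \<Longrightarrow> G z = 0"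
    and vac: "\<And>z. z \<in> interior {y \<in> slab T. \<rho> y = 0} \<Longrightarrow> G z = 0"
    and z: "z \<in> slab T"
  shows "G z = 0"
proof (rule ccontr)
  assume "G z \<noteq> 0"
  obtain V where V: "open V" "V \<inter> slab T = G -` (- {0}) \<inter> slab T"
    using G unfolding continuous_on_open_invariant by (metis open_Compl closed_singleton)
  then have "z \<in> V" using z \<open>G z \<noteq> 0\<close> by auto
  \<comment> \<open>The point is moved to a time strictly between 0 and \<open>T\<close>, where
    relatively open sets are open in space-time, as the interior in the tameness condition
    requires.\<close>
  have "z \<in> closure ({0<..<T} \<times> UNIV)" using z \<open>0 < T\<close> by (auto simp: closure_Times)
  then obtain y where y: "y \<in> V" "y \<in> {0<..<T} \<times> UNIV"
    using \<open>z \<in> V\<close> \<open>open V\<close> by (meson closure_iff_nhds_not_empty disjoint_iff subset_refl)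
  let ?W = "V \<inter> {0<..<T} \<times> UNIV"
  have "open ?W" using V by (intro open_Int open_Times) auto
  moreover have "?W \<subseteq> {y \<in> slab T. \<rho> y = 0}"
    using V(2) pos nonneg by (fastforce simp: le_less)
  ultimately have "y \<in> interior {y \<in> slab T. \<rho> y = 0}"
    using y by (meson IntI interiorI)
  then have "G y = 0" by (rule vac)
  moreover have "y \<in> V \<inter> slab T" using y by auto
  ultimately show False using V(2) by auto
qed

section \<open>The Euler equations in quasilinear form\<close>

lemma subluminal:
  fixes v :: "'a::real_normed_vector"
  assumes "0 < \<epsilon>" "norm v < 1 / \<epsilon>"
  shows "\<epsilon>\<^sup>2 * (norm v)\<^sup>2 < 1"
proof -
  have "norm (\<epsilon> *\<^sub>R v) < 1" using assms by (simp add: field_simps)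
  then have "(norm (\<epsilon> *\<^sub>R v))\<^sup>2 < 1" by (simp add: abs_square_less_1)
  then show ?thesis by (simp add: power_mult_distrib)
qed

text \<open>This is the product rule, with \<open>P\<close> in the role of p' and \<open>G\<close>
  the squared Lorentz factor, whose differential is
  \<open>2 * \<epsilon>\<^sup>2 * G\<^sup>2 * (u z \<bullet> U h)\<close>. The differential of the
  inertia \<open>G * q\<close> stays packed in \<open>E'\<close>, because it cancels as a whole
  between the two equations.\<close>

lemma euler_differentiated:
  fixes u :: "real \<times> (real ^ 'n) \<Rightarrow> real ^ 'n"
  assumes "0 < \<epsilon>" "0 < T" and z: "z \<in> slab T" and euler: "rel_euler \<epsilon> p T \<rho> u"
    and u_lt: "norm (u z) < 1 / \<epsilon>"
    and R: "(\<rho> has_derivative R) (at z within slab T)"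
    and U: "(u has_derivative U) (at z within slab T)"
    and P: "((\<lambda>y. p (\<rho> y)) has_derivative (\<lambda>h. P * R h)) (at z within slab T)"
  defines "G \<equiv> 1 / (1 - \<epsilon>\<^sup>2 * (norm (u z))\<^sup>2)"
  defines "q \<equiv> qfun \<epsilon> p (\<rho> z)"
  defines "E' \<equiv> \<lambda>h. G * (1 + \<epsilon>\<^sup>2 * P) * R h + 2 * \<epsilon>\<^sup>2 * q * G\<^sup>2 * (u z \<bullet> U h)"
  shows "E' (1, 0) - \<epsilon>\<^sup>2 * P * R (1, 0)
      + (\<Sum>k\<in>UNIV. E' (0, axis k 1) * u z $ k + G * q * U (0, axis k 1) $ k) = 0"
    and "E' (1, 0) * u z $ j + G * q * U (1, 0) $ j
      + (\<Sum>k\<in>UNIV. E' (0, axis k 1) * u z $ j * u z $ k + G * q * U (0, axis k 1) $ j * u z $ k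
          + G * q * u z $ j * U (0, axis k 1) $ k) + P * R (0, axis j 1) = 0"
proof -
  let ?F = "at z within slab T"
  have pos: "\<epsilon>\<^sup>2 * (norm (u z))\<^sup>2 < 1"
    using subluminal[OF \<open>0 < \<epsilon>\<close> u_lt] .
  have E: "(energy_inertia \<epsilon> p \<rho> u has_derivative E') ?F"
  proof -
    let ?D = "\<lambda>y. 1 - \<epsilon>\<^sup>2 * (u y \<bullet> u y)"
    have N: "((\<lambda>y. \<rho> y + \<epsilon>\<^sup>2 * p (\<rho> y)) has_derivative (\<lambda>h. (1 + \<epsilon>\<^sup>2 * P) * R h)) ?F"
      by (rule has_derivative_eq_rhs, (rule derivative_intros R P)+) (simp add: algebra_simps)
    have D: "(?D has_derivative (\<lambda>h. - (2 * \<epsilon>\<^sup>2 * (u z \<bullet> U h)))) ?F"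
      by (rule has_derivative_eq_rhs, (rule derivative_intros U)+) (simp add: algebra_simps inner_commute)
    have Dz: "1 - \<epsilon>\<^sup>2 * (u z \<bullet> u z) = 1 / G" and "G \<noteq> 0"
      using pos by (auto simp: G_def power2_norm_eq_inner)
    have qz: "\<rho> z + \<epsilon>\<^sup>2 * p (\<rho> z) = q" by (simp add: q_def qfun_def)
    have "((\<lambda>y. (\<rho> y + \<epsilon>\<^sup>2 * p (\<rho> y)) / ?D y) has_derivative E') ?F"
      unfolding E'_def
      by (intro has_derivative_eq_rhs[OF has_derivative_divide'[OF N D, unfolded Dz qz]] ext)
        (use \<open>G \<noteq> 0\<close> in \<open>simp_all add: field_simps power2_eq_square\<close>)
    then show ?thesis unfolding energy_inertia_def[abs_def] power2_norm_eq_inner .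
  qed
  have Ez: "energy_inertia \<epsilon> p \<rho> u z = G * q"
    unfolding energy_inertia_def G_def q_def qfun_def by simp
  have Uk: "((\<lambda>y. u y $ k) has_derivative (\<lambda>h. U h $ k)) ?F" for k
    using bounded_linear.has_derivative[OF bounded_linear_vec_nth U] .
  have dt1: "d_t T (\<lambda>y. energy_inertia \<epsilon> p \<rho> u y - \<epsilon>\<^sup>2 * p (\<rho> y)) z = E' (1, 0) - \<epsilon>\<^sup>2 * P * R (1, 0)"
    by (rule d_t_eq(1)[OF \<open>0 < T\<close> z, THEN trans])
      (auto intro!: derivative_eq_intros E P)
  have dx1: "d_x k (\<lambda>y. energy_inertia \<epsilon> p \<rho> u y * u y $ k) z
      = E' (0, axis k 1) * u z $ k + G * q * U (0, axis k 1) $ k" for k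
    by (rule d_x_eq[OF z, THEN trans]) (auto intro!: derivative_eq_intros E Uk simp: Ez)
  have dt2: "d_t T (\<lambda>y. energy_inertia \<epsilon> p \<rho> u y * u y $ j) z
      = E' (1, 0) * u z $ j + G * q * U (1, 0) $ j"
    by (rule d_t_eq(1)[OF \<open>0 < T\<close> z, THEN trans]) (auto intro!: derivative_eq_intros E Uk simp: Ez)
  have dx2: "d_x k (\<lambda>y. energy_inertia \<epsilon> p \<rho> u y * u y $ j * u y $ k
        + p (\<rho> y) * (if j = k then 1 else 0)) z
      = E' (0, axis k 1) * u z $ j * u z $ k + G * q * U (0, axis k 1) $ j * u z $ k
          + G * q * u z $ j * U (0, axis k 1) $ k + (if k = j then P * R (0, axis k 1) else 0)" for k
    by (rule d_x_eq[OF z, THEN trans])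
      (auto intro!: derivative_eq_intros E Uk P simp: Ez algebra_simps)
  show "E' (1, 0) - \<epsilon>\<^sup>2 * P * R (1, 0)
      + (\<Sum>k\<in>UNIV. E' (0, axis k 1) * u z $ k + G * q * U (0, axis k 1) $ k) = 0"
    using euler z unfolding rel_euler_def dt1[symmetric] dx1[symmetric] by blast
  have "E' (1, 0) * u z $ j + G * q * U (1, 0) $ j
      + (\<Sum>k\<in>UNIV. E' (0, axis k 1) * u z $ j * u z $ k + G * q * U (0, axis k 1) $ j * u z $ k
          + G * q * u z $ j * U (0, axis k 1) $ k + (if k = j then P * R (0, axis k 1) else 0)) = 0"
    using euler z unfolding rel_euler_def dt2[symmetric] dx2[symmetric] by blast
  then show "E' (1, 0) * u z $ j + G * q * U (1, 0) $ j
      + (\<Sum>k\<in>UNIV. E' (0, axis k 1) * u z $ j * u z $ k + G * q * U (0, axis k 1) $ j * u z $ k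
          + G * q * u z $ j * U (0, axis k 1) $ k) + P * R (0, axis j 1) = 0"
    by (simp add: sum.distrib)
qed

text \<open>Away from the vacuum, \<open>c \<nabla>\<rho> = q \<nabla>w\<close> with \<open>w\<close> the composition of \<open>wfun\<close> with the density.
  The momentum equation minus \<open>u\<^sub>j\<close> times the energy equation, divided by \<open>q\<close>, gives the first
  identity; \<open>c\<close> times the energy equation, divided by \<open>q\<close>, gives the second. Neither contains
  \<open>1 / q\<close> any more, so both survive at the vacuum.\<close>

lemma euler_quasilinear:
  fixes u :: "real \<times> (real ^ 'n) \<Rightarrow> real ^ 'n"
  assumes "0 < \<epsilon>" "0 < T" and z: "z \<in> slab T" and euler: "rel_euler \<epsilon> p T \<rho> u"
    and u_lt: "norm (u z) < 1 / \<epsilon>"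
    and R: "(\<rho> has_derivative R) (at z within slab T)"
    and U: "(u has_derivative U) (at z within slab T)"
    and P: "((\<lambda>y. p (\<rho> y)) has_derivative (\<lambda>h. c\<^sup>2 * R h)) (at z within slab T)"
    and q_pos: "0 < qfun \<epsilon> p (\<rho> z)"
    and W: "\<And>h. W h = c / qfun \<epsilon> p (\<rho> z) * R h"
  defines "G \<equiv> 1 / (1 - \<epsilon>\<^sup>2 * (norm (u z))\<^sup>2)"
  shows "G * (U (1, 0) $ j + (\<Sum>k\<in>UNIV. u z $ k * U (0, axis k 1) $ j))
      + c * (\<epsilon>\<^sup>2 * u z $ j * W (1, 0) + W (0, axis j 1)) = 0"
    and "(G + (G - 1) * \<epsilon>\<^sup>2 * c\<^sup>2) * W (1, 0) + c * (2 * \<epsilon>\<^sup>2 * G\<^sup>2 * (u z \<bullet> U (1, 0))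
        + (\<Sum>k\<in>UNIV. 2 * \<epsilon>\<^sup>2 * G\<^sup>2 * (u z \<bullet> U (0, axis k 1)) * u z $ k + G * U (0, axis k 1) $ k))
      + (\<Sum>k\<in>UNIV. G * (1 + \<epsilon>\<^sup>2 * c\<^sup>2) * W (0, axis k 1) * u z $ k) = 0"
proof -
  define q where "q = qfun \<epsilon> p (\<rho> z)"
  have "q > 0" using q_pos by (simp add: q_def)
  have cR: "c * R h = q * W h" for h using W[of h] \<open>q > 0\<close> by (simp add: q_def)
  define E' where "E' h = G * (1 + \<epsilon>\<^sup>2 * c\<^sup>2) * R h + 2 * \<epsilon>\<^sup>2 * q * G\<^sup>2 * (u z \<bullet> U h)" for h
  note eqs = euler_differentiated[OF assms(1-8), folded G_def q_def, folded E'_def]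
  define S where "S = (\<Sum>k\<in>UNIV. E' (0, axis k 1) * u z $ k + G * q * U (0, axis k 1) $ k)"
  have mass: "E' (1, 0) - \<epsilon>\<^sup>2 * c\<^sup>2 * R (1, 0) + S = 0"
    using eqs(1) by (simp add: S_def)
  have "E' (1, 0) * u z $ j + G * q * U (1, 0) $ j
      + (u z $ j * S + G * q * (\<Sum>k\<in>UNIV. u z $ k * U (0, axis k 1) $ j)) + c\<^sup>2 * R (0, axis j 1) = 0"
    using eqs(2)[of j] unfolding S_def sum_distrib_left sum.distrib[symmetric]
    by (simp add: algebra_simps)
  moreover have "c\<^sup>2 * R (1, 0) = q * (c * W (1, 0))" "c\<^sup>2 * R (0, axis j 1) = q * (c * W (0, axis j 1))"
    using cR[of "(1, 0)"] cR[of "(0, axis j 1)"] by algebra+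
  \<comment> \<open>\<open>mass\<close> turns \<open>E' (1, 0) + S\<close> into
    \<open>\<epsilon>\<^sup>2 * c\<^sup>2 * R (1, 0)\<close>; this is the origin of the term with
    \<open>W (1, 0)\<close>.\<close>
  ultimately have "q * (G * (U (1, 0) $ j + (\<Sum>k\<in>UNIV. u z $ k * U (0, axis k 1) $ j))
      + c * (\<epsilon>\<^sup>2 * u z $ j * W (1, 0) + W (0, axis j 1))) = 0"
    using mass by algebra
  then show "G * (U (1, 0) $ j + (\<Sum>k\<in>UNIV. u z $ k * U (0, axis k 1) $ j))
      + c * (\<epsilon>\<^sup>2 * u z $ j * W (1, 0) + W (0, axis j 1)) = 0"
    using \<open>q > 0\<close> by simp
  have cE: "c * E' h = q * (G * (1 + \<epsilon>\<^sup>2 * c\<^sup>2) * W h + c * (2 * \<epsilon>\<^sup>2 * G\<^sup>2 * (u z \<bullet> U h)))" for h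
    unfolding E'_def using cR[of h] by algebra
  have "c * S = (\<Sum>k\<in>UNIV. (c * E' (0, axis k 1)) * u z $ k + c * G * q * U (0, axis k 1) $ k)"
    by (simp add: S_def sum_distrib_left algebra_simps)
  also have "\<dots> = q * (c * (\<Sum>k\<in>UNIV. 2 * \<epsilon>\<^sup>2 * G\<^sup>2 * (u z \<bullet> U (0, axis k 1)) * u z $ k
        + G * U (0, axis k 1) $ k)
      + (\<Sum>k\<in>UNIV. G * (1 + \<epsilon>\<^sup>2 * c\<^sup>2) * W (0, axis k 1) * u z $ k))"
    unfolding cE sum_distrib_left sum.distrib[symmetric]
    by (intro sum.cong) (auto simp: algebra_simps)
  finally have cS: "c * S = q * (c * (\<Sum>k\<in>UNIV. 2 * \<epsilon>\<^sup>2 * G\<^sup>2 * (u z \<bullet> U (0, axis k 1)) * u z $ k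
        + G * U (0, axis k 1) $ k)
      + (\<Sum>k\<in>UNIV. G * (1 + \<epsilon>\<^sup>2 * c\<^sup>2) * W (0, axis k 1) * u z $ k))" .
  \<comment> \<open>The coefficient \<open>G * (1 + \<epsilon>\<^sup>2 * c\<^sup>2)\<close> of
    \<open>W (1, 0)\<close> loses \<open>\<epsilon>\<^sup>2 * c\<^sup>2\<close> to the pressure
    term. The rest is at least 1 because \<open>G\<close> is, so it can later be dropped from an
    estimate of the time derivative.\<close>
  have "c * E' (1, 0) - \<epsilon>\<^sup>2 * c\<^sup>2 * (c * R (1, 0)) + c * S = 0"
    using mass by algebra
  then have "q * ((G + (G - 1) * \<epsilon>\<^sup>2 * c\<^sup>2) * W (1, 0) + c * (2 * \<epsilon>\<^sup>2 * G\<^sup>2 * (u z \<bullet> U (1, 0))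
        + (\<Sum>k\<in>UNIV. 2 * \<epsilon>\<^sup>2 * G\<^sup>2 * (u z \<bullet> U (0, axis k 1)) * u z $ k + G * U (0, axis k 1) $ k))
      + (\<Sum>k\<in>UNIV. G * (1 + \<epsilon>\<^sup>2 * c\<^sup>2) * W (0, axis k 1) * u z $ k)) = 0"
    unfolding cE cS cR by algebra
  then show "(G + (G - 1) * \<epsilon>\<^sup>2 * c\<^sup>2) * W (1, 0) + c * (2 * \<epsilon>\<^sup>2 * G\<^sup>2 * (u z \<bullet> U (1, 0))
        + (\<Sum>k\<in>UNIV. 2 * \<epsilon>\<^sup>2 * G\<^sup>2 * (u z \<bullet> U (0, axis k 1)) * u z $ k + G * U (0, axis k 1) $ k))
      + (\<Sum>k\<in>UNIV. G * (1 + \<epsilon>\<^sup>2 * c\<^sup>2) * W (0, axis k 1) * u z $ k) = 0"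
    using \<open>q > 0\<close> by simp
qed

text \<open>The chain rule is applied within the half line that contains all densities, since at a
  vacuum point only the right derivative of \<open>p\<close> is given.\<close>

lemma pressure_composed_derivative:
  assumes "C1_on {0..} p" and nonneg: "\<And>z. z \<in> S \<Longrightarrow> 0 \<le> \<rho> z" and z: "z \<in> S"
    and R: "(\<rho> has_derivative R) (at z within S)"
  shows "((\<lambda>y. p (\<rho> y)) has_derivative (\<lambda>h. dpress p (\<rho> z) * R h)) (at z within S)"
proof (rule has_derivative_in_compose2[where t = "{0..}" and g' = "\<lambda>r h. dpress p r * h"])
  show "(p has_derivative (*) (dpress p r)) (at r within {0..})" if "r \<in> {0..}" for r
    using pressure_derivative(1)[OF assms(1)] that by (simp add: has_field_derivative_def)
qed (use assms in auto)

lemma C1_on_Pair: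
  assumes "C1_on S (\<lambda>z. (f z, g z))"
  shows "C1_on S f" "C1_on S g"
proof -
  obtain F where F: "\<And>z. z \<in> S \<Longrightarrow> ((\<lambda>z. (f z, g z)) has_derivative blinfun_apply (F z)) (at z within S)"
    and cont: "continuous_on S F"
    using assms unfolding C1_on_def by auto
  show "C1_on S f" unfolding C1_on_def
  proof (intro exI conjI ballI)
    show "(f has_derivative blinfun_apply (fst_blinfun o\<^sub>L F z)) (at z within S)" if "z \<in> S" for z
      using has_derivative_fst[OF F[OF that]]
      by (simp add: fst_blinfun.rep_eq blinfun_compose.rep_eq o_def)
  qed (intro continuous_intros cont)
  show "C1_on S g" unfolding C1_on_def
  proof (intro exI conjI ballI)
    show "(g has_derivative blinfun_apply (snd_blinfun o\<^sub>L F z)) (at z within S)" if "z \<in> S" for z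
      using has_derivative_snd[OF F[OF that]]
      by (simp add: snd_blinfun.rep_eq blinfun_compose.rep_eq o_def)
  qed (intro continuous_intros cont)
qed

lemma C1_on_imp_continuous_on:
  assumes "C1_on S f"
  shows "continuous_on S f"
proof -
  obtain f' where "\<forall>x\<in>S. (f has_derivative blinfun_apply (f' x)) (at x within S)"
    using assms unfolding C1_on_def by (elim exE conjE)
  then show ?thesis
    unfolding continuous_on_eq_continuous_within by (intro ballI has_derivative_continuous) (rule bspec)
qed

section \<open>The quasilinear system up to the vacuum\<close>

context
  fixes \<epsilon> T :: real and p :: "real \<Rightarrow> real"
    and \<rho> :: "real \<times> (real ^ 'n) \<Rightarrow> real" and u :: "real \<times> (real ^ 'n) \<Rightarrow> real ^ 'n"
    and Du :: "real \<times> (real ^ 'n) \<Rightarrow> (real \<times> (real ^ 'n)) \<Rightarrow>\<^sub>L (real ^ 'n)"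
    and Dw :: "real \<times> (real ^ 'n) \<Rightarrow> (real \<times> (real ^ 'n)) \<Rightarrow>\<^sub>L real"
  assumes eps_pos: "0 < \<epsilon>" and T_pos: "0 < T"
    and p_regular: "C1_on {0..} p"
    and dpress_nonneg: "\<And>r. 0 \<le> r \<Longrightarrow> 0 \<le> dpress p r"
    and q_pos: "\<And>r. 0 < r \<Longrightarrow> 0 < qfun \<epsilon> p r"
    and w_finite: "\<And>r. 0 \<le> r \<Longrightarrow> (\<lambda>s. sound p s / qfun \<epsilon> p s) integrable_on {0..r}"
    and tame: "tame_solution \<epsilon> p T \<rho> u"
    and Du: "\<And>z. z \<in> slab T \<Longrightarrow> (u has_derivative Du z) (at z within slab T)"
    and Du_cont: "continuous_on (slab T) Du"
    and Dw: "\<And>z. z \<in> slab T \<Longrightarrow> ((\<lambda>z. wfun \<epsilon> p (\<rho> z)) has_derivative Dw z) (at z within slab T)"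
    and Dw_cont: "continuous_on (slab T) Dw"
begin

lemma rho_nonneg: "z \<in> slab T \<Longrightarrow> 0 \<le> \<rho> z"
  and u_subluminal: "z \<in> slab T \<Longrightarrow> norm (u z) < 1 / \<epsilon>"
  and euler: "rel_euler \<epsilon> p T \<rho> u"
  using tame unfolding tame_solution_def by blast+

lemma rho_C1: "C1_on (slab T) \<rho>"
  by (rule C1_on_Pair(1)[where g = u]) (use tame in \<open>simp add: tame_solution_def\<close>)

lemma rho_differentiable:
  assumes "z \<in> slab T"
  shows "\<exists>R. (\<rho> has_derivative R) (at z within slab T)"
  using rho_C1 assms unfolding C1_on_def by auto

lemma u_cont: "continuous_on (slab T) u"
  unfolding continuous_on_eq_continuous_within by (intro ballI has_derivative_continuous[OF Du])

lemma sound_cont: "continuous_on (slab T) (\<lambda>z. sound p (\<rho> z))"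
  using rho_nonneg
  by (intro continuous_on_compose2[OF continuous_on_sound[OF p_regular]
        C1_on_imp_continuous_on[OF rho_C1]]) auto

lemma gamma_cont: "continuous_on (slab T) (\<lambda>z. 1 / (1 - \<epsilon>\<^sup>2 * (norm (u z))\<^sup>2))"
proof -
  have "\<forall>z\<in>slab T. 1 - \<epsilon>\<^sup>2 * (norm (u z))\<^sup>2 \<noteq> 0"
    using subluminal[OF eps_pos u_subluminal] by fastforce
  then show ?thesis by (intro continuous_intros u_cont)
qed

lemma gamma_ge_1:
  assumes "z \<in> slab T"
  shows "1 \<le> 1 / (1 - \<epsilon>\<^sup>2 * (norm (u z))\<^sup>2)"
  using subluminal[OF eps_pos u_subluminal[OF assms]] by (simp add: field_simps)

lemma quasilinear_positive_density:
  assumes z: "z \<in> slab T" and pos: "0 < \<rho> z"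
  defines "c \<equiv> sound p (\<rho> z)" and "G \<equiv> 1 / (1 - \<epsilon>\<^sup>2 * (norm (u z))\<^sup>2)"
  shows "G * (Du z (1, 0) $ j + (\<Sum>k\<in>UNIV. u z $ k * Du z (0, axis k 1) $ j))
      + c * (\<epsilon>\<^sup>2 * u z $ j * Dw z (1, 0) + Dw z (0, axis j 1)) = 0"
    and "(G + (G - 1) * \<epsilon>\<^sup>2 * c\<^sup>2) * Dw z (1, 0) + c * (2 * \<epsilon>\<^sup>2 * G\<^sup>2 * (u z \<bullet> Du z (1, 0))
        + (\<Sum>k\<in>UNIV. 2 * \<epsilon>\<^sup>2 * G\<^sup>2 * (u z \<bullet> Du z (0, axis k 1)) * u z $ k + G * Du z (0, axis k 1) $ k))
      + (\<Sum>k\<in>UNIV. G * (1 + \<epsilon>\<^sup>2 * c\<^sup>2) * Dw z (0, axis k 1) * u z $ k) = 0"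
proof -
  obtain R where R: "(\<rho> has_derivative R) (at z within slab T)"
    using rho_differentiable[OF z] by (rule exE)
  define W where "W = (\<lambda>h. c / qfun \<epsilon> p (\<rho> z) * R h)"
  have "dpress p (\<rho> z) = c\<^sup>2"
    using dpress_nonneg[of "\<rho> z"] pos by (simp add: c_def sound_def)
  then have P: "((\<lambda>y. p (\<rho> y)) has_derivative (\<lambda>h. c\<^sup>2 * R h)) (at z within slab T)"
    using pressure_composed_derivative[OF p_regular rho_nonneg z R] by simp
  have "(wfun \<epsilon> p has_derivative (*) (c / qfun \<epsilon> p (\<rho> z))) (at (\<rho> z))"
    using wfun_has_derivative[OF p_regular dpress_nonneg q_pos w_finite pos]
    by (simp add: has_field_derivative_def c_def)
  then have W': "((\<lambda>y. wfun \<epsilon> p (\<rho> y)) has_derivative W) (at z within slab T)"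
    unfolding W_def by (rule has_derivative_compose[OF R])
  \<comment> \<open>\<open>W\<close> from the chain rule and the given \<open>Dw z\<close> both
    compute the same partial derivatives of w, so they agree on the vectors that matter.\<close>
  have W_eq: "W (1, 0) = Dw z (1, 0)" "W (0, axis k 1) = Dw z (0, axis k 1)" for k
    using trans[OF d_t_eq(1)[OF T_pos z W', symmetric] d_t_eq(1)[OF T_pos z Dw[OF z]]]
      trans[OF d_x_eq[OF z W', symmetric] d_x_eq[OF z Dw[OF z]]] .
  note quasi = euler_quasilinear[OF eps_pos T_pos z euler u_subluminal[OF z] R Du[OF z] P
      q_pos[OF pos] fun_cong[OF W_def], folded G_def, unfolded W_eq]
  show "G * (Du z (1, 0) $ j + (\<Sum>k\<in>UNIV. u z $ k * Du z (0, axis k 1) $ j))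
      + c * (\<epsilon>\<^sup>2 * u z $ j * Dw z (1, 0) + Dw z (0, axis j 1)) = 0"
    by (rule quasi(1))
  show "(G + (G - 1) * \<epsilon>\<^sup>2 * c\<^sup>2) * Dw z (1, 0) + c * (2 * \<epsilon>\<^sup>2 * G\<^sup>2 * (u z \<bullet> Du z (1, 0))
        + (\<Sum>k\<in>UNIV. 2 * \<epsilon>\<^sup>2 * G\<^sup>2 * (u z \<bullet> Du z (0, axis k 1)) * u z $ k + G * Du z (0, axis k 1) $ k))
      + (\<Sum>k\<in>UNIV. G * (1 + \<epsilon>\<^sup>2 * c\<^sup>2) * Dw z (0, axis k 1) * u z $ k) = 0"
    by (rule quasi(2))
qed

text \<open>On a neighbourhood of such a point w is identically zero, so its full derivative
  vanishes; the velocity equation is condition (iii) of tameness, read componentwise.\<close>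

lemma vacuum_interior:
  assumes z: "z \<in> interior {y \<in> slab T. \<rho> y = 0}"
  shows "Dw z (1, 0) = 0" "Dw z (0, axis k 1) = 0"
    and "Du z (1, 0) $ j + (\<Sum>k\<in>UNIV. u z $ k * Du z (0, axis k 1) $ j) = 0"
proof -
  let ?I = "interior {y \<in> slab T. \<rho> y = 0}"
  have slab: "z \<in> slab T" using z interior_subset by blast
  have "?I \<subseteq> slab T" using interior_subset by blast
  have "((\<lambda>y. wfun \<epsilon> p (\<rho> y)) has_derivative Dw z) (at z)"
    using has_derivative_subset[OF Dw[OF slab] \<open>?I \<subseteq> slab T\<close>]
    unfolding at_within_open[OF z open_interior] .
  moreover have "((\<lambda>y. wfun \<epsilon> p (\<rho> y)) has_derivative (\<lambda>h. 0)) (at z)"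
  proof (rule has_derivative_transform_within_open[OF has_derivative_const[of 0] _ z])
    show "0 = wfun \<epsilon> p (\<rho> y)" if "y \<in> ?I" for y
    proof -
      have "\<rho> y = 0" using subsetD[OF interior_subset that] by simp
      then show ?thesis by (simp add: wfun_def)
    qed
  qed simp
  ultimately have "blinfun_apply (Dw z) = (\<lambda>h. 0)" by (rule has_derivative_unique)
  then show "Dw z (1, 0) = 0" "Dw z (0, axis k 1) = 0" by simp_all
  have "d_t T u z + (\<Sum>k\<in>UNIV. (u z $ k) *\<^sub>R d_x k u z) = 0"
    using tame z unfolding tame_solution_def by blast
  then have "Du z (1, 0) + (\<Sum>k\<in>UNIV. (u z $ k) *\<^sub>R Du z (0, axis k 1)) = 0"
    unfolding d_t_eq(1)[OF T_pos slab Du[OF slab]] d_x_eq[OF slab Du[OF slab]] .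
  then have "(Du z (1, 0) + (\<Sum>k\<in>UNIV. (u z $ k) *\<^sub>R Du z (0, axis k 1))) $ j = 0"
    by simp
  then show "Du z (1, 0) $ j + (\<Sum>k\<in>UNIV. u z $ k * Du z (0, axis k 1) $ j) = 0"
    by simp
qed

lemma quasilinear:
  assumes c0: "sound p 0 = 0" and z: "z \<in> slab T"
  defines "c \<equiv> sound p (\<rho> z)" and "G \<equiv> 1 / (1 - \<epsilon>\<^sup>2 * (norm (u z))\<^sup>2)"
  shows "G * (Du z (1, 0) $ j + (\<Sum>k\<in>UNIV. u z $ k * Du z (0, axis k 1) $ j))
      + c * (\<epsilon>\<^sup>2 * u z $ j * Dw z (1, 0) + Dw z (0, axis j 1)) = 0" (is ?velocity)
    and "(G + (G - 1) * \<epsilon>\<^sup>2 * c\<^sup>2) * Dw z (1, 0) + c * (2 * \<epsilon>\<^sup>2 * G\<^sup>2 * (u z \<bullet> Du z (1, 0))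
        + (\<Sum>k\<in>UNIV. 2 * \<epsilon>\<^sup>2 * G\<^sup>2 * (u z \<bullet> Du z (0, axis k 1)) * u z $ k + G * Du z (0, axis k 1) $ k))
      + (\<Sum>k\<in>UNIV. G * (1 + \<epsilon>\<^sup>2 * c\<^sup>2) * Dw z (0, axis k 1) * u z $ k) = 0" (is ?density)
proof -
  have rho0: "\<rho> y = 0" if "y \<in> interior {y \<in> slab T. \<rho> y = 0}" for y
    using subsetD[OF interior_subset that] by simp
  define g where "g z = 1 / (1 - \<epsilon>\<^sup>2 * (norm (u z))\<^sup>2)" for z
  have g: "continuous_on (slab T) g"
    using gamma_cont by (simp add: g_def[abs_def])
  note dense = slab_dense[where \<rho> = \<rho>, OF T_pos _ _ _ _ z]
  note cont = continuous_intros u_cont sound_cont Du_cont Dw_cont g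
  show ?velocity unfolding c_def G_def g_def[symmetric]
  proof (rule dense)
    show "continuous_on (slab T) (\<lambda>z. g z * (Du z (1, 0) $ j + (\<Sum>k\<in>UNIV. u z $ k * Du z (0, axis k 1) $ j))
      + sound p (\<rho> z) * (\<epsilon>\<^sup>2 * u z $ j * Dw z (1, 0) + Dw z (0, axis j 1)))"
      by (intro cont)
  qed (rule rho_nonneg, assumption, rule quasilinear_positive_density(1)[folded g_def], assumption+, simp add: rho0 c0 vacuum_interior(3))
  show ?density unfolding c_def G_def g_def[symmetric]
  proof (rule dense)
    show "continuous_on (slab T) (\<lambda>z. (g z + (g z - 1) * \<epsilon>\<^sup>2 * (sound p (\<rho> z))\<^sup>2) * Dw z (1, 0)
      + sound p (\<rho> z) * (2 * \<epsilon>\<^sup>2 * (g z)\<^sup>2 * (u z \<bullet> Du z (1, 0))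
        + (\<Sum>k\<in>UNIV. 2 * \<epsilon>\<^sup>2 * (g z)\<^sup>2 * (u z \<bullet> Du z (0, axis k 1)) * u z $ k + g z * Du z (0, axis k 1) $ k))
      + (\<Sum>k\<in>UNIV. g z * (1 + \<epsilon>\<^sup>2 * (sound p (\<rho> z))\<^sup>2) * Dw z (0, axis k 1) * u z $ k))"
      by (intro cont)
  qed (rule rho_nonneg, assumption, rule quasilinear_positive_density(2)[folded g_def], assumption+, simp add: rho0 c0 vacuum_interior(1,2))
qed

text \<open>All coefficients in \<open>quasilinear\<close> are continuous, hence bounded on the
  compact segment of all times at \<open>x\<close>. The bound \<open>M\<close> may depend on
  \<open>x\<close>, but not on the time.\<close>

lemma time_derivative_bound:
  assumes c0: "sound p 0 = 0"
  obtains M where "0 \<le> M"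
    "\<And>s. s \<in> {0..T} \<Longrightarrow> norm (Du (s, x) (1, 0)) \<le> M * (sound p (\<rho> (s, x)) + norm (u (s, x)))"
    "\<And>s. s \<in> {0..T} \<Longrightarrow> \<bar>Dw (s, x) (1, 0)\<bar> \<le> M * (sound p (\<rho> (s, x)) + norm (u (s, x)))"
proof -
  define c where "c z = sound p (\<rho> z)" for z
  define G where "G z = 1 / (1 - \<epsilon>\<^sup>2 * (norm (u z))\<^sup>2)" for z
  \<comment> \<open>\<open>a\<close> and \<open>d\<close> contain time derivatives again. Both occur
    only with a factor \<open>c\<close>, so their boundedness is enough and nothing has to be solved
    for.\<close>
  define a where "a z = 2 * \<epsilon>\<^sup>2 * (G z)\<^sup>2 * (u z \<bullet> Du z (1, 0))
        + (\<Sum>k\<in>UNIV. 2 * \<epsilon>\<^sup>2 * (G z)\<^sup>2 * (u z \<bullet> Du z (0, axis k 1)) * u z $ k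
            + G z * Du z (0, axis k 1) $ k)" for z
  define b where "b z k = G z * (1 + \<epsilon>\<^sup>2 * (c z)\<^sup>2) * Dw z (0, axis k 1)" for z k
  define d where "d z j = \<epsilon>\<^sup>2 * u z $ j * Dw z (1, 0) + Dw z (0, axis j 1)" for z j
  define M1 where "M1 z = (\<Sum>j\<in>UNIV. (\<Sum>k\<in>UNIV. \<bar>Du z (0, axis k 1) $ j\<bar>) + \<bar>d z j\<bar>)" for z
  define M2 where "M2 z = \<bar>a z\<bar> + (\<Sum>k\<in>UNIV. \<bar>b z k\<bar>)" for z
  have M1: "norm (Du z (1, 0)) \<le> M1 z * (c z + norm (u z))"
    and M2: "\<bar>Dw z (1, 0)\<bar> \<le> M2 z * (c z + norm (u z))"
    and M_nonneg: "0 \<le> M1 z" "0 \<le> M2 z" and c_nonneg: "0 \<le> c z" if z: "z \<in> slab T" for z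
  proof -
    show c: "0 \<le> c z" using rho_nonneg[OF z] dpress_nonneg by (simp add: c_def sound_def)
    have G: "1 \<le> G z" using gamma_ge_1[OF z] by (simp add: G_def)
    show "0 \<le> M1 z" "0 \<le> M2 z" by (auto simp: M1_def M2_def intro!: sum_nonneg add_nonneg_nonneg)
    have uk: "\<bar>u z $ k\<bar> \<le> norm (u z)" for k by (rule component_le_norm_cart)
    have "\<bar>Du z (1, 0) $ j\<bar> \<le> ((\<Sum>k\<in>UNIV. \<bar>Du z (0, axis k 1) $ j\<bar>) + \<bar>d z j\<bar>) * (c z + norm (u z))" for j
    proof -
      have eq: "Du z (1, 0) $ j = - (\<Sum>k\<in>UNIV. u z $ k * Du z (0, axis k 1) $ j) - c z * d z j / G z"
        using quasilinear(1)[OF c0 z, of j, folded G_def c_def d_def] G by (simp add: field_simps)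
      have "\<bar>\<Sum>k\<in>UNIV. u z $ k * Du z (0, axis k 1) $ j\<bar>
          \<le> (\<Sum>k\<in>UNIV. \<bar>Du z (0, axis k 1) $ j\<bar>) * norm (u z)"
        unfolding sum_distrib_right
        by (rule order_trans[OF sum_abs])
          (auto intro!: sum_mono mult_left_mono simp: abs_mult uk mult.commute[of "\<bar>u z $ _\<bar>"])
      moreover have "\<bar>c z * d z j / G z\<bar> \<le> \<bar>d z j\<bar> * c z"
        using G c divide_left_mono[of 1 "G z" "\<bar>d z j\<bar> * c z"] by (simp add: abs_mult mult.commute)
      ultimately have "\<bar>Du z (1, 0) $ j\<bar>
          \<le> (\<Sum>k\<in>UNIV. \<bar>Du z (0, axis k 1) $ j\<bar>) * norm (u z) + \<bar>d z j\<bar> * c z"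
        unfolding eq by linarith
      also have "\<dots> \<le> (\<Sum>k\<in>UNIV. \<bar>Du z (0, axis k 1) $ j\<bar>) * (c z + norm (u z))
          + \<bar>d z j\<bar> * (c z + norm (u z))"
        using c by (intro add_mono mult_left_mono sum_nonneg) auto
      finally show ?thesis by (simp add: algebra_simps)
    qed
    then have "(\<Sum>j\<in>UNIV. \<bar>Du z (1, 0) $ j\<bar>) \<le> M1 z * (c z + norm (u z))"
      unfolding M1_def sum_distrib_right by (intro sum_mono)
    then show "norm (Du z (1, 0)) \<le> M1 z * (c z + norm (u z))"
      using norm_le_l1_cart[of "Du z (1, 0)"] by linarith
    let ?A = "G z + (G z - 1) * \<epsilon>\<^sup>2 * (c z)\<^sup>2"
    have "1 \<le> ?A" using G by (simp add: add_increasing2)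
    then have "\<bar>Dw z (1, 0)\<bar> \<le> \<bar>?A * Dw z (1, 0)\<bar>"
      by (simp add: abs_mult mult_le_cancel_right1)
    also have "?A * Dw z (1, 0) = - (c z * a z) - (\<Sum>k\<in>UNIV. b z k * u z $ k)"
      using quasilinear(2)[OF c0 z, folded G_def c_def, folded a_def b_def] by linarith
    also have "\<bar>\<dots>\<bar> \<le> \<bar>c z * a z\<bar> + \<bar>\<Sum>k\<in>UNIV. b z k * u z $ k\<bar>" by linarith
    also have "\<dots> \<le> \<bar>a z\<bar> * c z + (\<Sum>k\<in>UNIV. \<bar>b z k\<bar> * norm (u z))"
      using c by (intro add_mono order_trans[OF sum_abs] sum_mono)
        (auto simp: abs_mult uk intro!: mult_left_mono)
    also have "\<dots> \<le> \<bar>a z\<bar> * (c z + norm (u z)) + (\<Sum>k\<in>UNIV. \<bar>b z k\<bar> * (c z + norm (u z)))"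
      using c by (intro add_mono sum_mono mult_left_mono) auto
    finally show "\<bar>Dw z (1, 0)\<bar> \<le> M2 z * (c z + norm (u z))"
      by (simp add: M2_def algebra_simps sum_distrib_left sum.distrib)
  qed
  have G_cont: "continuous_on (slab T) G"
    using gamma_cont by (simp add: G_def[abs_def])
  have "continuous_on (slab T) (\<lambda>z. M1 z + M2 z)"
    unfolding M1_def M2_def a_def b_def d_def c_def
    by (intro continuous_intros u_cont sound_cont Du_cont Dw_cont G_cont)
  then have "continuous_on ({0..T} \<times> {x}) (\<lambda>z. M1 z + M2 z)"
    by (rule continuous_on_subset) auto
  then have "bounded ((\<lambda>z. M1 z + M2 z) ` ({0..T} \<times> {x}))"
    by (intro compact_imp_bounded compact_continuous_image compact_Times) auto
  then obtain M where M: "\<And>s. s \<in> {0..T} \<Longrightarrow> \<bar>M1 (s, x) + M2 (s, x)\<bar> \<le> M"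
    unfolding bounded_iff by fastforce
  show ?thesis
  proof
    show "0 \<le> M" using M[of 0] T_pos by force
    fix s assume s: "s \<in> {0..T}"
    then have z: "(s, x) \<in> slab T" by auto
    have "M1 (s, x) \<le> M" "M2 (s, x) \<le> M" using M[OF s] M_nonneg[OF z] by linarith+
    then show "norm (Du (s, x) (1, 0)) \<le> M * (sound p (\<rho> (s, x)) + norm (u (s, x)))"
      and "\<bar>Dw (s, x) (1, 0)\<bar> \<le> M * (sound p (\<rho> (s, x)) + norm (u (s, x)))"
      using M1[OF z] M2[OF z] c_nonneg[OF z] unfolding c_def
      by (meson add_nonneg_nonneg mult_right_mono norm_ge_zero order_trans)+
  qed
qed

section \<open>Propagation of zero\<close>

text \<open>Gronwall's inequality is applied to w^2 + |u|^2; the squares keep this quantity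
  differentiable where u = 0. The bound of \<open>sound\<close> by \<open>C\<close> times w replaces
  c by w and closes the inequality.\<close>

lemma velocity_stays_zero:
  assumes C: "0 \<le> C" "\<And>r. 0 \<le> r \<Longrightarrow> r < \<delta> \<Longrightarrow> sound p r \<le> C * wfun \<epsilon> p r" and "0 < \<delta>"
    and ab: "0 \<le> a" "a \<le> b" "b \<le> T"
    and small: "\<And>s. s \<in> {a..b} \<Longrightarrow> \<rho> (s, x) < \<delta>"
    and init: "\<rho> (a, x) = 0" "u (a, x) = 0" and s: "s \<in> {a..b}"
  shows "u (s, x) = 0"
proof -
  have sound_nn: "0 \<le> sound p r" if "0 \<le> r" for r using dpress_nonneg that by (simp add: sound_def)
  have c0: "sound p 0 = 0"
    using C(2)[of 0] sound_nn[of 0] \<open>0 < \<delta>\<close> by (simp add: wfun_def)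
  obtain M where M: "0 \<le> M"
    "\<And>s. s \<in> {0..T} \<Longrightarrow> norm (Du (s, x) (1, 0)) \<le> M * (sound p (\<rho> (s, x)) + norm (u (s, x)))"
    "\<And>s. s \<in> {0..T} \<Longrightarrow> \<bar>Dw (s, x) (1, 0)\<bar> \<le> M * (sound p (\<rho> (s, x)) + norm (u (s, x)))"
    using time_derivative_bound[OF c0, of x] by metis
  define w where "w s = wfun \<epsilon> p (\<rho> (s, x))" for s
  define v where "v s = u (s, x)" for s
  define y where "y s = (w s)\<^sup>2 + v s \<bullet> v s" for s
  define y' where "y' s = 2 * w s * Dw (s, x) (1, 0) + 2 * (v s \<bullet> Du (s, x) (1, 0))" for s
  have "y s = 0"
  proof (rule gronwall_zero[OF \<open>a \<le> b\<close> _ _ _ _ s])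
    fix t assume t: "t \<in> {a..b}"
    then have t': "t \<in> {0..T}" and z: "(t, x) \<in> slab T" using ab by auto
    have "(w has_real_derivative Dw (t, x) (1, 0)) (at t within {0..T})"
      using d_t_eq(2)[OF T_pos z Dw[OF z]]
      by (simp add: w_def[abs_def] has_real_derivative_iff_has_vector_derivative)
    then have w': "(w has_real_derivative Dw (t, x) (1, 0)) (at t within {a..b})"
      by (rule DERIV_subset) (use ab in auto)
    have "(v has_vector_derivative Du (t, x) (1, 0)) (at t within {0..T})"
      using d_t_eq(2)[OF T_pos z Du[OF z]] by (simp add: v_def[abs_def])
    then have v': "(v has_vector_derivative Du (t, x) (1, 0)) (at t within {a..b})"
      by (rule has_vector_derivative_within_subset) (use ab in auto)
    have "((\<lambda>t. v t \<bullet> v t) has_real_derivative 2 * (v t \<bullet> Du (t, x) (1, 0))) (at t within {a..b})"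
      using bounded_bilinear.has_vector_derivative[OF bounded_bilinear_inner v' v']
      by (simp add: has_real_derivative_iff_has_vector_derivative inner_commute)
    then show "(y has_real_derivative y' t) (at t within {a..b})"
      unfolding y_def[abs_def] y'_def
      by (auto intro!: derivative_eq_intros w' simp: algebra_simps)
    have w_nn: "0 \<le> w t" unfolding w_def
      using wfun_nonneg[OF p_regular dpress_nonneg q_pos w_finite rho_nonneg[OF z]] .
    have c: "sound p (\<rho> (t, x)) \<le> C * w t"
      unfolding w_def using C(2) rho_nonneg[OF z] small[OF t] by blast
    have S: "M * (sound p (\<rho> (t, x)) + norm (v t)) \<le> M * (C * w t + norm (v t))"
      using c M(1) by (intro mult_left_mono) auto
    have "w t * Dw (t, x) (1, 0) \<le> w t * (M * (C * w t + norm (v t)))"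
      using M(3)[OF t'] S w_nn by (intro mult_left_mono) (auto simp: v_def)
    moreover have "v t \<bullet> Du (t, x) (1, 0) \<le> norm (v t) * (M * (C * w t + norm (v t)))"
      using M(2)[OF t'] S
      by (intro order_trans[OF norm_cauchy_schwarz] mult_left_mono) (auto simp: v_def)
    ultimately have "y' t \<le> 2 * M * ((w t + norm (v t)) * (C * w t + norm (v t)))"
      unfolding y'_def by (simp add: algebra_simps)
    also have "\<dots> \<le> 2 * M * ((w t + norm (v t)) * ((C + 1) * (w t + norm (v t))))"
      using w_nn C(1) M(1) by (intro mult_left_mono) (auto simp: algebra_simps)
    also have "\<dots> = 2 * M * (C + 1) * (w t + norm (v t))\<^sup>2"
      by (simp add: power2_eq_square)
    \<comment> \<open>The inner factor 2 is that of (a + b)^2 <= 2 (a^2 + b^2), which leads to the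
      constant \<open>4 * M * (C + 1)\<close>.\<close>
    also have "\<dots> \<le> 2 * M * (C + 1) * (2 * y t)"
      using C(1) M(1) sum_squares_bound[of "w t" "norm (v t)"]
      by (intro mult_left_mono) (auto simp: y_def power2_sum power2_norm_eq_inner)
    finally show "y' t \<le> 4 * M * (C + 1) * y t" by simp
    show "0 \<le> y t" by (simp add: y_def)
  next
    show "y a = 0" using init by (simp add: y_def w_def v_def wfun_def)
  qed
  then show ?thesis
    by (simp add: y_def v_def add_nonneg_eq_0_iff)
qed

text \<open>Knowing \<open>w = 0\<close> does not give \<open>\<rho> = 0\<close>, because \<open>c\<close> may vanish identically near \<open>0\<close>. Instead, the
  energy equation reduces to \<open>\<partial>\<^sub>t \<rho> = 0\<close> where the velocity vanishes on a neighbourhood.\<close>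

lemma density_stays_zero:
  assumes ab: "0 \<le> a" "a \<le> b" "b \<le> T" and "open S" "x \<in> S"
    and u0: "\<And>s y. s \<in> {a..b} \<Longrightarrow> y \<in> S \<Longrightarrow> u (s, y) = 0"
    and init: "\<rho> (a, x) = 0" and s: "s \<in> {a..b}"
  shows "\<rho> (s, x) = 0"
proof (rule gronwall_zero[where L = 0 and y = "\<lambda>s. \<rho> (s, x)" and y' = "\<lambda>_. 0", OF \<open>a \<le> b\<close> _ _ _ _ s])
  fix t assume t: "t \<in> {a..b}"
  then have z: "(t, x) \<in> slab T" using ab by auto
  obtain R where R: "(\<rho> has_derivative R) (at (t, x) within slab T)"
    using rho_differentiable[OF z] by (rule exE)
  have "Du (t, x) (0, axis k 1) = 0" for k
  proof -
    let ?h = "\<lambda>h::real. x + h *\<^sub>R axis k 1"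
    have "open (?h -` S)" using \<open>open S\<close> by (intro open_vimage continuous_intros) auto
    moreover have "0 \<in> ?h -` S" using \<open>x \<in> S\<close> by simp
    ultimately have "((\<lambda>h. u (t, ?h h)) has_vector_derivative 0) (at 0)"
      using u0[OF t] by (intro has_vector_derivative_transform_within_open[OF has_vector_derivative_const[of 0]]) auto
    then show ?thesis
      using d_x_eq[OF z Du[OF z], of k] by (simp add: d_x_def vector_derivative_at)
  qed
  \<comment> \<open>Here \<open>G\<close> is 1, the two terms with the derivative of the pressure
    cancel, and the flux leaves only a multiple of the divergence of u, which is zero.\<close>
  then have "R (1, 0) = 0"
    using euler_differentiated(1)[OF eps_pos T_pos z euler u_subluminal[OF z] R Du[OF z]
        pressure_composed_derivative[OF p_regular rho_nonneg z R]] u0[OF t \<open>x \<in> S\<close>]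
    by (simp add: algebra_simps)
  then have "((\<lambda>s. \<rho> (s, x)) has_real_derivative 0) (at t within {0..T})"
    using d_t_eq(2)[OF T_pos z R] by (simp add: has_real_derivative_iff_has_vector_derivative)
  then show "((\<lambda>s. \<rho> (s, x)) has_real_derivative 0) (at t within {a..b})"
    by (rule DERIV_subset) (use ab in auto)
  show "0 \<le> \<rho> (t, x)" using rho_nonneg[OF z] .
qed (use init in auto)

text \<open>The bound \<open>c \<le> C w\<close> is available only for densities below \<open>\<delta>\<close>, so the argument advances in time steps
  over which \<open>\<rho>\<close> varies by less than \<open>\<delta>\<close>.\<close>

lemma stays_zero_on_ball:
  assumes C: "0 \<le> C" "\<And>r. 0 \<le> r \<Longrightarrow> r < \<delta> \<Longrightarrow> sound p r \<le> C * wfun \<epsilon> p r" and "0 < \<delta>"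
    and init: "\<And>y. y \<in> ball x r \<Longrightarrow> \<rho> (0, y) = 0 \<and> u (0, y) = 0"
    and t: "t \<in> {0..T}" and y: "y \<in> ball x r"
  shows "\<rho> (t, y) = 0 \<and> u (t, y) = 0"
proof -
  \<comment> \<open>One time step has to serve all points of the ball, hence uniform continuity on
    the compact closed ball.\<close>
  have "continuous_on ({0..T} \<times> cball x r) \<rho>"
    by (rule continuous_on_subset[OF C1_on_imp_continuous_on[OF rho_C1]]) auto
  then have "uniformly_continuous_on ({0..T} \<times> cball x r) \<rho>"
    by (intro compact_uniformly_continuous compact_Times) auto
  then obtain \<eta> where "0 < \<eta>" and \<eta>: "\<And>z z'. z \<in> {0..T} \<times> cball x r \<Longrightarrow> z' \<in> {0..T} \<times> cball x r \<Longrightarrow>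
      dist z' z < \<eta> \<Longrightarrow> dist (\<rho> z') (\<rho> z) < \<delta>"
    unfolding uniformly_continuous_on_def using \<open>0 < \<delta>\<close> by meson
  \<comment> \<open>Steps of length \<open>\<eta> / 2\<close> stay strictly below
    \<open>\<eta>\<close>, so a density starting from 0 remains below \<open>\<delta>\<close>
    throughout a step.\<close>
  have "\<forall>t\<in>{0..T}. t \<le> real k * (\<eta> / 2) \<longrightarrow> (\<forall>y\<in>ball x r. \<rho> (t, y) = 0 \<and> u (t, y) = 0)" for k
  proof (induction k)
    case 0
    then show ?case using init by auto
  next
    case (Suc k)
    define a where "a = real k * (\<eta> / 2)"
    have a: "0 \<le> a" using \<open>0 < \<eta>\<close> by (simp add: a_def)
    show ?case
    proof (intro ballI impI)
      fix t y assume t: "t \<in> {0..T}" "t \<le> real (Suc k) * (\<eta> / 2)" and y: "y \<in> ball x r"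
      show "\<rho> (t, y) = 0 \<and> u (t, y) = 0"
      proof (cases "t \<le> a")
        case True
        then show ?thesis using Suc t y by (auto simp: a_def)
      next
        case False
        then have ab: "0 \<le> a" "a \<le> t" "t \<le> T" and a0: "\<And>y. y \<in> ball x r \<Longrightarrow> \<rho> (a, y) = 0 \<and> u (a, y) = 0"
          using a t Suc by (auto simp: a_def)
        \<comment> \<open>The velocity must vanish on the whole ball first: the density argument at
          one point uses spatial derivatives of u there.\<close>
        have u0: "u (s, y') = 0" if s: "s \<in> {a..t}" and y': "y' \<in> ball x r" for s y'
        proof (rule velocity_stays_zero[OF C \<open>0 < \<delta>\<close> ab _ _ _ s])
          show "\<rho> (s', y') < \<delta>" if "s' \<in> {a..t}" for s'
          proof -
            have "dist (s', y') (a, y') < \<eta>"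
              using that t \<open>0 < \<eta>\<close> by (auto simp: dist_Pair_Pair dist_real_def a_def algebra_simps)
            then have "dist (\<rho> (s', y')) (\<rho> (a, y')) < \<delta>"
              using that ab y' by (intro \<eta>) auto
            then show ?thesis using a0[OF y'] by (simp add: dist_real_def)
          qed
        qed (use a0[OF y'] in auto)
        have "\<rho> (t, y) = 0"
          by (rule density_stays_zero[OF ab open_ball y u0]) (use ab a0[OF y] in auto)
        then show ?thesis using u0[of t y] ab y by auto
      qed
    qed
  qed
  moreover obtain k where "t / (\<eta> / 2) < real k"
    using reals_Archimedean2 by (rule exE)
  then have "t \<le> real k * (\<eta> / 2)"
    using \<open>0 < \<eta>\<close> by (simp add: field_simps)
  ultimately show ?thesis using t y by blast
qed

end

theorem theorem5p2:
  fixes \<epsilon> T :: real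
    and p :: "real \<Rightarrow> real"
    and \<rho> :: "real \<times> (real ^ 'n) \<Rightarrow> real"
    and u :: "real \<times> (real ^ 'n) \<Rightarrow> real ^ 'n"
  assumes eps_pos: "\<epsilon> > 0"
    and T_pos: "T > 0"
    and p_regular: "C1_on {0..} p"
    and hyperbolic: "\<And>r. r \<ge> 0 \<Longrightarrow> 0 \<le> dpress p r \<and> dpress p r < 1 / \<epsilon>\<^sup>2"
    and q_pos: "\<And>r. r > 0 \<Longrightarrow> qfun \<epsilon> p r > 0"
    and w_finite: "\<And>r. r \<ge> 0 \<Longrightarrow> (\<lambda>s. sound p s / qfun \<epsilon> p s) integrable_on {0..r}"
    and vacuum: "Limsup (at_right 0) (\<lambda>r. ereal (sound p r / wfun \<epsilon> p r)) < \<infinity>"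
    and tame: "tame_solution \<epsilon> p T \<rho> u"
    and compact_support: "compact (supp_on (slab T) (\<lambda>z. (\<rho> z, u z)))"
  shows "\<forall>t\<in>{0..T}. supp_on UNIV (\<lambda>x. (\<rho> (t, x), u (t, x)))
                    \<subseteq> supp_on UNIV (\<lambda>x. (\<rho> (0, x), u (0, x)))"
proof (intro ballI subsetI, rule ccontr)
  fix t x
  assume t: "t \<in> {0..T}" and x: "x \<in> supp_on UNIV (\<lambda>x. (\<rho> (t, x), u (t, x)))"
    and x0: "x \<notin> supp_on UNIV (\<lambda>x. (\<rho> (0, x), u (0, x)))"
  have dpress_nonneg: "0 \<le> dpress p r" if "0 \<le> r" for r using hyperbolic that by blast
  obtain C \<delta> where C: "0 \<le> C" "0 < \<delta>" "\<And>r. 0 \<le> r \<Longrightarrow> r < \<delta> \<Longrightarrow> sound p r \<le> C * wfun \<epsilon> p r"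
    using sound_le_wfun[OF p_regular dpress_nonneg q_pos w_finite vacuum] by blast
  have "C1_on (slab T) u"
    by (rule C1_on_Pair(2)[where f = \<rho>]) (use tame in \<open>simp add: tame_solution_def\<close>)
  then obtain Du
    where Du: "\<And>z. z \<in> slab T \<Longrightarrow> (u has_derivative blinfun_apply (Du z)) (at z within slab T)"
      "continuous_on (slab T) Du"
    unfolding C1_on_def by auto
  have "C1_on (slab T) (\<lambda>z. wfun \<epsilon> p (\<rho> z))"
    using tame by (simp add: tame_solution_def)
  then obtain Dw
    where Dw: "\<And>z. z \<in> slab T \<Longrightarrow> ((\<lambda>z. wfun \<epsilon> p (\<rho> z)) has_derivative blinfun_apply (Dw z)) (at z within slab T)"
      "continuous_on (slab T) Dw"
    unfolding C1_on_def by auto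
  \<comment> \<open>Leaving the support means having a ball of vanishing initial data. This same
    ball, not a shrinking one, stays at zero up to time \<open>t\<close>.\<close>
  have "open (- closure {x. (\<rho> (0, x), u (0, x)) \<noteq> 0})"
    by (rule open_Compl[OF closed_closure])
  moreover have "x \<in> - closure {x. (\<rho> (0, x), u (0, x)) \<noteq> 0}"
    using x0 by (simp add: supp_on_def)
  ultimately obtain r where "0 < r" and r: "ball x r \<subseteq> - closure {x. (\<rho> (0, x), u (0, x)) \<noteq> 0}"
    by (rule openE)
  have "\<rho> (0, y) = 0 \<and> u (0, y) = 0" if "y \<in> ball x r" for y
  proof -
    have "y \<notin> closure {x. (\<rho> (0, x), u (0, x)) \<noteq> 0}" using subsetD[OF r that] by simp
    then have "y \<notin> {x. (\<rho> (0, x), u (0, x)) \<noteq> 0}" by (meson closure_subset subsetD)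
    then show ?thesis by (simp add: zero_prod_def)
  qed
  then have zero: "\<rho> (t, y) = 0 \<and> u (t, y) = 0" if "y \<in> ball x r" for y
    using stays_zero_on_ball[OF eps_pos T_pos p_regular dpress_nonneg q_pos w_finite tame Du Dw
        C(1,3,2) _ t that] by blast
  have "x \<in> closure {x. (\<rho> (t, x), u (t, x)) \<noteq> 0}" using x by (simp add: supp_on_def)
  then obtain y where "y \<in> ball x r" "(\<rho> (t, y), u (t, y)) \<noteq> 0"
    using \<open>0 < r\<close> unfolding closure_approachable by (auto simp: dist_commute)
  then show False using zero by (simp add: zero_prod_def)
qed

end
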